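(* Let $$E(x,y)=\sum_{\pi\in\mathcal{F}}x^{|\pi|}y^{\mathrm{trun}(\pi)-1}p^{\#112(\pi)}q^{\#212(\pi)}r^{\#312(\pi)}$$ be the generating function that enumerates the members of $\mathcal{F}$ jointly according to length, $\mathrm{trun}-1$, $\#112$, $\#212$ and $\#312$ (marked by $x$, $y$, $p$, $q$ and $r$, respectively). Then \begin{align*} E(x,y)&=\frac{x-3x^2-(p-3)x^3+(p-1)x^4-x^3y\left(q-1+(r-2q+1)x+(p-1)(r-q)x^2\right)}{(1-x)\left(1-x-(p-1)x^2\right)\left(1-x-xy-(p-1)x^2y\right)}\\ &\quad+\frac{x-x^2+x^2y\left(q-1+(r-2q+1)x+(p-1)(r-q)x^2\right)}{\left(1-x-(p-1)x^2\right)\left(1-x-xy-(p-1)x^2y\right)}\,V, \end{align*} where $V=E(x,1)=\dfrac{x\alpha}{(1-x)\beta}$ with \begin{align*} \alpha&=1-3x-(p+q-4)x^2+(p+2q-r-2)x^3+(p-1)(q-r)x^4,\\ \beta&=1-4x-(2p+q-6)x^2+(3p+2q-r-4)x^3+(p-1)(p+q-r-1)x^4. \end{align*}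
   Context: A Catalan word of length $n\geq 1$ is an integer sequence $\pi=\pi_1\cdots\pi_n$ with $\pi_1=1$ and $1\leq \pi_{i+1}\leq \pi_i+1$ for $1\leq i\leq n-1$. A (weakly) increasing run of a word is a maximal nondecreasing string of consecutive letters. A Catalan word is flattened if the sequence of first letters of its increasing runs, read from left to right, is nondecreasing. $\mathcal{F}_n$ is the set of flattened Catalan words of length $n$, $\mathcal{F}=\cup_{n\geq 1}\mathcal{F}_n$, and $|\pi|$ is the length of $\pi$. For a word $w$, $\mathrm{trun}(w)$ is the number of distinct letters appearing in the rightmost increasing run of $w$. For a pattern $\tau=\tau_1\cdots\tau_m$, $\#\tau(\pi)$ is the number of occurrences of $\tau$ in $\pi$ as a consecutive (subword) pattern, i.e., the number of indices $i$ such that $\pi_i\pi_{i+1}\cdots\pi_{i+m-1}$ is order-isomorphic to $\tau$. Here $x,y,p,q,r$ are indeterminates and generating functions are formal power series in $x$ with coefficients polynomial in $y,p,q,r$. *)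

theory Defs
  imports "HOL-Computational_Algebra.Computational_Algebra"
begin

definition catalan_word :: "nat list \<Rightarrow> bool" where
  "catalan_word w \<longleftrightarrow> w \<noteq> [] \<and> hd w = 1 \<and>
     (\<forall>i. Suc i < length w \<longrightarrow> 1 \<le> w ! Suc i \<and> w ! Suc i \<le> w ! i + 1)"

fun runs :: "'a::linorder list \<Rightarrow> 'a list list" where
  "runs [] = []"
| "runs [a] = [[a]]"
| "runs (a # b # w) =
     (if a \<le> b then (a # hd (runs (b # w))) # tl (runs (b # w)) else [a] # runs (b # w))"

lemma runs_eq_Nil_iff [simp]: "runs w = [] \<longleftrightarrow> w = []"
  by (induction w rule: runs.induct) auto

lemma hd_hd_runs: "w \<noteq> [] \<Longrightarrow> hd (runs w) \<noteq> [] \<and> hd (hd (runs w)) = hd w"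
  by (induction w rule: runs.induct) auto

text \<open>The list \<open>runs w\<close> is the factorization of \<open>w\<close> into maximal nondecreasing
  factors: the factors are nonempty and nondecreasing, and there is a descent between any two
  neighbouring ones.\<close>

lemma concat_runs: "concat (runs w) = w"
proof (induction w rule: runs.induct)
  case (3 a b w)
  then show ?case by (cases "runs (b # w)") auto
qed auto

lemma runs_nondecreasing: "\<forall>u \<in> set (runs w). u \<noteq> [] \<and> sorted u"
proof (induction w rule: runs.induct)
  case (3 a b w)
  obtain u us where u: "runs (b # w) = u # us"
    by (metis list.exhaust list.distinct(1) runs_eq_Nil_iff)
  have "u \<noteq> []" "hd u = b"
    using hd_hd_runs[of "b # w"] u by auto
  then obtain v where "u = b # v" by (cases u) auto
  with 3 u show ?case by (auto intro: order_trans)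
qed auto

lemma runs_maximal: "successively (\<lambda>u v. last u > hd v) (runs w)"
proof (induction w rule: runs.induct)
  case (3 a b w)
  obtain u us where u: "runs (b # w) = u # us"
    by (metis list.exhaust list.distinct(1) runs_eq_Nil_iff)
  have "u \<noteq> []" "hd u = b"
    using hd_hd_runs[of "b # w"] u by auto
  with 3 u show ?case by (cases us) auto
qed auto

definition flattened :: "'a::linorder list \<Rightarrow> bool" where
  "flattened w \<longleftrightarrow> sorted (map hd (runs w))"

definition flat_catalan :: "nat \<Rightarrow> nat list set" where
  "flat_catalan n = {w. catalan_word w \<and> flattened w \<and> length w = n}"

definition trun :: "'a::linorder list \<Rightarrow> nat" where
  "trun w = card (set (last (runs w)))"

definition order_isomorphic :: "'a::linorder list \<Rightarrow> 'b::linorder list \<Rightarrow> bool" where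
  "order_isomorphic u v \<longleftrightarrow> length u = length v \<and>
     (\<forall>i < length u. \<forall>j < length u. u ! i < u ! j \<longleftrightarrow> v ! i < v ! j)"

definition occurrences :: "nat list \<Rightarrow> 'a::linorder list \<Rightarrow> nat" where
  "occurrences t w =
     card {i. i + length t \<le> length w \<and> order_isomorphic (take (length t) (drop i w)) t}"

lemma catalan_word_le:
  assumes "catalan_word w" "i < length w"
  shows "w ! i \<le> Suc i"
  using assms(2)
proof (induction i)
  case 0
  then show ?case using assms(1) by (auto simp: catalan_word_def hd_conv_nth)
next
  case (Suc i)
  then show ?case using assms(1) by (fastforce simp: catalan_word_def)
qed

lemma finite_flat_catalan: "finite (flat_catalan n)"
proof (rule finite_subset)
  show "flat_catalan n \<subseteq> {w. set w \<subseteq> {..n} \<and> length w = n}"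
    by (force simp: flat_catalan_def in_set_conv_nth dest: catalan_word_le)
qed (simp add: finite_lists_length_eq)

text \<open>The ring \<open>\<int>[r][q][p][y]\<close>: the outermost polynomial variable is \<open>y\<close>, so that setting
  \<open>y = 1\<close> is plain polynomial evaluation.\<close>

type_synonym coeffs = "int poly poly poly poly"

definition var_y :: coeffs where "var_y = [:0, 1:]"
definition var_p :: coeffs where "var_p = [:[:0, 1:]:]"
definition var_q :: coeffs where "var_q = [:[:[:0, 1:]:]:]"
definition var_r :: coeffs where "var_r = [:[:[:[:0, 1:]:]:]:]"

definition weight :: "nat list \<Rightarrow> coeffs" where
  "weight w = var_y ^ (trun w - 1) * var_p ^ occurrences [1, 1, 2] w *
     var_q ^ occurrences [2, 1, 2] w * var_r ^ occurrences [3, 1, 2] w"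

definition E_gf :: "coeffs fps" where
  "E_gf = Abs_fps (\<lambda>n. \<Sum>w \<in> flat_catalan n. weight w)"

definition set_y_1 :: "coeffs fps \<Rightarrow> coeffs fps" where
  "set_y_1 F = Abs_fps (\<lambda>n. [: poly (fps_nth F n) 1 :])"

text \<open>Power series division in the library needs coefficients in a field, so identities
  between quotients are stated over the field of fractions of the coefficient ring; the
  embedding is injective.\<close>

definition to_fract_fps :: "'a::idom fps \<Rightarrow> 'a fract fps" where
  "to_fract_fps F = Abs_fps (\<lambda>n. to_fract (fps_nth F n))"

end

theory Submission
  imports Defs
begin

text \<open>Flattened Catalan words are built one letter at a time from the right end. If the last run
  of \<open>w\<close> starts with \<open>s\<close> and ends with \<open>e\<close>, then \<open>w\<close> followed by \<open>c\<close> is again a flattened Catalan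
  word exactly when \<open>s \<le> c \<le> e + 1\<close>: a smaller \<open>c\<close> would start a run with a letter below \<open>s\<close>, a
  larger one would jump. Since a run of a Catalan word skips no letter, the exponent of \<open>y\<close> is
  \<open>trun - 1 = e - s\<close>. So one extension raises this exponent by one (\<open>c = e + 1\<close>), one leaves it alone
  (\<open>c = e\<close>), and exactly \<open>e - s\<close> extensions are descents, which reset it to zero.

  An occurrence of 112, 212 or 312 ends with a rise, and a rise can only be by one. Hence a new
  occurrence appears only for \<open>c = e + 1\<close>, and which of the three it is depends on the step before
  that: a level step gives 112, a descent by one gives 212, a deeper descent gives 312. Of the
  \<open>k = e - s\<close> possible descents one is by one (if \<open>k > 0\<close>) and the other \<open>k - 1\<close> are deeper.

  Let \<open>U\<close> be the series like \<open>E\<close> in which each word carries also the factor that a following rise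
  would contribute. Counting the \<open>e - s\<close> descents amounts to taking \<open>\<partial>/\<partial>y\<close> at \<open>y = 1\<close>. With
  \<open>V = E(x,1)\<close>, \<open>Z = E(x,0)\<close> and \<open>D = E\<^sub>y(x,1)\<close> the extension step reads
  \<open>E = x + x (y U + E + D)\<close> and \<open>U = x + x (y U + p E + q (V - Z) + r (D - V + Z))\<close>
  (lemmas \<open>E_gf_nth_Suc\<close> and \<open>rise_sum_Suc\<close>). Evaluating these two equations and their
  \<open>y\<close>-derivatives at \<open>y = 1\<close>, and the first one also at \<open>y = 0\<close>, yields enough linear equations to
  determine all the series; they are solved in \<open>linear_system_solution\<close>.\<close>

section \<open>Appending a letter to a flattened Catalan word\<close>

lemma runs_snoc:
  "w \<noteq> [] \<Longrightarrow> runs (w @ [c]) =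
     (if last w \<le> c then butlast (runs w) @ [last (runs w) @ [c]] else runs w @ [[c]])"
proof (induction w rule: runs.induct)
  case (3 a b w)
  obtain u us where u: "runs (b # w) = u # us"
    by (metis list.exhaust list.distinct(1) runs_eq_Nil_iff)
  with 3 show ?case by (cases us) auto
qed auto

lemma last_run: "w \<noteq> [] \<Longrightarrow> last (runs w) \<noteq> [] \<and> last (last (runs w)) = last w"
proof (induction w rule: rev_induct)
  case (snoc c w)
  then show ?case by (cases "w = []") (auto simp: runs_snoc)
qed simp

abbreviation run_start :: "'a::linorder list \<Rightarrow> 'a" where
  "run_start w \<equiv> hd (last (runs w))"

lemma run_start_snoc:
  "w \<noteq> [] \<Longrightarrow> run_start (w @ [c]) = (if last w \<le> c then run_start w else c)"
  using last_run[of w] by (simp add: runs_snoc)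

lemma run_start_le_last:
  assumes "w \<noteq> []"
  shows "run_start w \<le> last w"
proof -
  have "last (runs w) \<in> set (runs w)" using assms by simp
  then have "sorted (last (runs w))" using runs_nondecreasing by blast
  then show ?thesis using last_run[OF assms]
    by (metis last_ConsL last_ConsR list.collapse order_refl sorted_simps(2) last_in_set)
qed

text \<open>Either \<open>c\<close> prolongs the last run, whose first letter is then automatically at most \<open>c\<close>, or it
  starts a new run and is compared with the first letter of the run before.\<close>

lemma flattened_snoc:
  assumes "w \<noteq> []"
  shows "flattened (w @ [c]) \<longleftrightarrow> flattened w \<and> run_start w \<le> c"
proof -
  have r: "runs w = butlast (runs w) @ [last (runs w)]"
    using assms by simp
  have "sorted (map hd (runs w) @ [c]) \<longleftrightarrow> sorted (map hd (runs w)) \<and> run_start w \<le> c"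
    by (subst (1 2) r) (auto simp: sorted_append)
  moreover have "map hd (butlast (runs w) @ [last (runs w) @ [c]]) = map hd (runs w)"
    by (subst (3) r) (use last_run[OF assms] in auto)
  ultimately show ?thesis
    using run_start_le_last[OF assms] unfolding flattened_def runs_snoc[OF assms] by auto
qed

lemma catalan_word_snoc:
  assumes "w \<noteq> []"
  shows "catalan_word (w @ [c]) \<longleftrightarrow> catalan_word w \<and> 1 \<le> c \<and> c \<le> Suc (last w)"
proof -
  \<comment> \<open>the index \<open>length w - 1\<close> contributes the step from the last letter of \<open>w\<close> to \<open>c\<close>\<close>
  have "(\<forall>i. Suc i < length (w @ [c]) \<longrightarrow>
          1 \<le> (w @ [c]) ! Suc i \<and> (w @ [c]) ! Suc i \<le> (w @ [c]) ! i + 1) \<longleftrightarrow>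
        (\<forall>i. Suc i < length w \<longrightarrow> 1 \<le> w ! Suc i \<and> w ! Suc i \<le> w ! i + 1) \<and>
          1 \<le> c \<and> c \<le> Suc (last w)" (is "?A \<longleftrightarrow> ?B \<and> ?C")
  proof -
    have "?C \<longleftrightarrow> 1 \<le> (w @ [c]) ! Suc (length w - 1) \<and>
                (w @ [c]) ! Suc (length w - 1) \<le> (w @ [c]) ! (length w - 1) + 1"
      using assms by (simp add: nth_append last_conv_nth)
    moreover have "?B \<longleftrightarrow> (\<forall>i. Suc i < length w \<longrightarrow>
        1 \<le> (w @ [c]) ! Suc i \<and> (w @ [c]) ! Suc i \<le> (w @ [c]) ! i + 1)"
      by (simp add: nth_append)
    moreover have "Suc i < length (w @ [c]) \<longleftrightarrow> Suc i < length w \<or> i = length w - 1" for i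
      using assms by (cases w) auto
    ultimately show ?thesis by blast
  qed
  then show ?thesis using assms by (auto simp: catalan_word_def)
qed

lemma run_start_pos: "catalan_word w \<Longrightarrow> 1 \<le> run_start w"
proof (induction w rule: rev_induct)
  case (snoc c w)
  show ?case
  proof (cases "w = []")
    case True
    with snoc.prems show ?thesis by (simp add: catalan_word_def)
  next
    case False
    with snoc show ?thesis by (auto simp: catalan_word_snoc run_start_snoc)
  qed
qed (simp add: catalan_word_def)

text \<open>A run of a Catalan word rises by at most one at each step, so it skips no letter.\<close>

lemma set_last_run: "catalan_word w \<Longrightarrow> set (last (runs w)) = {run_start w..last w}"
proof (induction w rule: rev_induct)
  case (snoc c w)
  show ?case
  proof (cases "w = []")
    case False
    with snoc have "set (last (runs w)) = {run_start w..last w}" "c \<le> Suc (last w)"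
      by (auto simp: catalan_word_snoc)
    with False run_start_le_last[of w] show ?thesis
      by (auto simp: runs_snoc run_start_snoc last_run)
  qed simp
qed (simp add: catalan_word_def)

lemma trun_eq: "catalan_word w \<Longrightarrow> trun w = Suc (last w) - run_start w"
  by (simp add: trun_def set_last_run)

lemma flat_catalan_0: "flat_catalan 0 = {}"
  by (auto simp: flat_catalan_def catalan_word_def)

lemma flat_catalan_1: "flat_catalan (Suc 0) = {[1]}"
  by (auto simp: flat_catalan_def catalan_word_def flattened_def length_Suc_conv)

lemma flat_catalan_Suc:
  assumes "n > 0"
  shows "flat_catalan (Suc n) =
    (\<lambda>(w, c). w @ [c]) ` (SIGMA w : flat_catalan n. {run_start w..Suc (last w)})"
    (is "?L = ?R")
proof -
  have *: "w @ [c] \<in> ?L \<longleftrightarrow> w \<in> flat_catalan n \<and> c \<in> {run_start w..Suc (last w)}" for w c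
    using assms run_start_pos[of w]
    by (cases "w = []") (auto simp: flat_catalan_def catalan_word_snoc flattened_snoc)
  show ?thesis
  proof (intro equalityI subsetI)
    fix v assume v: "v \<in> ?L"
    then obtain w c where "v = w @ [c]"
      by (cases v rule: rev_cases) (auto simp: flat_catalan_def)
    with * v show "v \<in> ?R" by force
  qed (use * in force)
qed

lemma sum_flat_catalan_Suc:
  fixes f :: "nat list \<Rightarrow> 'b::comm_monoid_add"
  assumes "n > 0"
  shows "(\<Sum>w \<in> flat_catalan (Suc n). f w) =
    (\<Sum>w \<in> flat_catalan n. \<Sum>c = run_start w..Suc (last w). f (w @ [c]))"
proof -
  have inj: "inj_on (\<lambda>(w, c). w @ [c]) A" for A :: "(nat list \<times> nat) set"
    by (auto simp: inj_on_def)
  show ?thesis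
    unfolding flat_catalan_Suc[OF assms] sum.reindex[OF inj]
    by (simp add: sum.Sigma finite_flat_catalan case_prod_unfold del: sum.cl_ivl_Suc)
qed

section \<open>Pattern occurrences created by the appended letter\<close>

lemma occurrences_eq_0: "length w < length t \<Longrightarrow> occurrences t w = 0"
  by (simp add: occurrences_def)

text \<open>Only one window of length \<open>length t\<close> contains the appended position.\<close>

lemma occurrences_snoc:
  assumes "t \<noteq> []" "length t \<le> Suc (length w)"
  shows "occurrences t (w @ [c]) = occurrences t w +
    (if order_isomorphic (drop (Suc (length w) - length t) (w @ [c])) t then 1 else 0)"
proof -
  define m where "m = Suc (length w) - length t"
  define occ where
    "occ v i \<longleftrightarrow> i + length t \<le> length v \<and> order_isomorphic (take (length t) (drop i v)) t"
    for v :: "'a list" and i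
  define new where "new \<longleftrightarrow> order_isomorphic (drop m (w @ [c])) t"
  have "occ (w @ [c]) i \<longleftrightarrow> occ w i" if "i \<noteq> m" for i
    using assms that by (auto simp: occ_def m_def)
  moreover have "occ (w @ [c]) m \<longleftrightarrow> new"
    using assms by (simp add: occ_def m_def new_def)
  moreover have m: "\<not> occ w m" using assms by (cases t) (auto simp: occ_def m_def)
  ultimately have "occ (w @ [c]) i \<longleftrightarrow> occ w i \<or> i = m \<and> new" for i
    by (cases "i = m") simp_all
  then have "{i. occ (w @ [c]) i} = {i. occ w i} \<union> (if new then {m} else {})"
    by auto
  moreover have "finite {i. occ w i}"
    by (rule finite_subset[of _ "{..length w}"]) (auto simp: occ_def)
  ultimately have "card {i. occ (w @ [c]) i} = card {i. occ w i} + (if new then 1 else 0)"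
    using m by simp
  then show ?thesis by (simp add: occurrences_def occ_def new_def m_def)
qed

lemma order_isomorphic_112: "order_isomorphic [a, b, c] [Suc 0, Suc 0, 2] \<longleftrightarrow> a = b \<and> b < c"
  by (auto simp: order_isomorphic_def All_less_Suc)

lemma order_isomorphic_212: "order_isomorphic [a, b, c] [2, Suc 0, 2] \<longleftrightarrow> a = c \<and> b < c"
  by (auto simp: order_isomorphic_def All_less_Suc)

lemma order_isomorphic_312: "order_isomorphic [a, b, c] [3, Suc 0, 2] \<longleftrightarrow> b < c \<and> c < a"
  by (auto simp: order_isomorphic_def All_less_Suc)

text \<open>Counterparts of the variables \<open>p\<close>, \<open>q\<close>, \<open>r\<close> in the coefficient ring \<open>\<int>[r][q][p]\<close> of the
  polynomials in \<open>y\<close>. With them the weight of a word becomes a single monomial in \<open>y\<close>, so that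
  evaluation at \<open>y = 0\<close> or \<open>y = 1\<close> and derivatives can be computed.\<close>

definition mark_p :: "int poly poly poly" where "mark_p = [:0, 1:]"
definition mark_q :: "int poly poly poly" where "mark_q = [:[:0, 1:]:]"
definition mark_r :: "int poly poly poly" where "mark_r = [:[:[:0, 1:]:]:]"

definition mark :: "nat list \<Rightarrow> int poly poly poly" where
  "mark w = mark_p ^ occurrences [1, 1, 2] w * mark_q ^ occurrences [2, 1, 2] w *
     mark_r ^ occurrences [3, 1, 2] w"

text \<open>The factor by which appending \<open>last w + 1\<close> multiplies the pattern weight. A single letter
  has no preceding step and gets the factor of a rise, since in neither case a pattern is
  completed.\<close>

definition rise :: "nat list \<Rightarrow> int poly poly poly" where
  "rise w = (if length w < 2 then 1 else
     let a = last (butlast w); b = last w in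
     if a < b then 1 else if a = b then mark_p else if a = Suc b then mark_q else mark_r)"

lemma rise_snoc:
  "w \<noteq> [] \<Longrightarrow> rise (w @ [c]) = (if last w < c then 1 else if last w = c then mark_p
     else if last w = Suc c then mark_q else mark_r)"
  by (cases w) (auto simp: rise_def Let_def)

text \<open>All three patterns end with a rise, so nothing is gained unless \<open>c = last w + 1\<close>. The last
  three letters \<open>a, b, b + 1\<close> then form 112 if \<open>a = b\<close>, 212 if \<open>a = b + 1\<close>, 312 if
  \<open>a > b + 1\<close>, and none of them if \<open>a < b\<close>.\<close>

lemma mark_snoc:
  assumes "w \<noteq> []" "c \<le> Suc (last w)"
  shows "mark (w @ [c]) = (if c = Suc (last w) then rise w else 1) * mark w"
proof (cases "length w < 2")
  case True
  then show ?thesis by (simp add: mark_def occurrences_eq_0 rise_def)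
next
  case False
  obtain u a b where w: "w = u @ [a, b]"
  proof -
    obtain v b where v: "w = v @ [b]" using assms by (cases w rule: rev_cases) auto
    with False obtain u a where "v = u @ [a]" by (cases v rule: rev_cases) auto
    with v that show ?thesis by simp
  qed
  have occ: "occurrences t (u @ [a, b, c]) = occurrences t (u @ [a, b]) +
      (if order_isomorphic [a, b, c] t then 1 else 0)" if "length t = 3" for t :: "nat list"
    using occurrences_snoc[of t w c] that by (cases t) (auto simp: w)
  show ?thesis
    using assms unfolding mark_def
    by (auto simp: occ order_isomorphic_112 order_isomorphic_212
        order_isomorphic_312 rise_def w butlast_append)
qed

section \<open>The total weight of the children of a word\<close>

text \<open>This is \<open>trun w - 1\<close> for a Catalan word, and also the number of letters that can follow \<open>w\<close>
  as a descent.\<close>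

abbreviation spread :: "nat list \<Rightarrow> nat" where
  "spread w \<equiv> last w - run_start w"

lemma weight_eq: "catalan_word w \<Longrightarrow> weight w = monom (mark w) (spread w)"
proof -
  assume w: "catalan_word w"
  have "trun w - 1 = spread w" using w by (simp add: trun_eq)
  moreover have vars: "var_y = monom 1 1" "var_p = monom mark_p 0" "var_q = monom mark_q 0"
      "var_r = monom mark_r 0"
    by (simp_all add: var_p_def var_q_def var_r_def var_y_def mark_p_def mark_q_def mark_r_def
        monom_altdef)
  ultimately show ?thesis
    unfolding weight_def mark_def unfolding vars by (simp add: monom_power mult_monom)
qed

definition rise_weight :: "nat list \<Rightarrow> coeffs" where
  "rise_weight w = monom (rise w * mark w) (spread w)"

lemma sum_children:
  fixes f :: "nat \<Rightarrow> 'a::comm_monoid_add"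
  assumes "s \<le> e"
  shows "(\<Sum>c = s..Suc e. f c) = f (Suc e) + f e + (\<Sum>c \<in> {s..<e}. f c)"
proof -
  have "{s..Suc e} = insert (Suc e) (insert e {s..<e})" using assms by auto
  then show ?thesis by (simp add: add.assoc)
qed

text \<open>The three summands belong to the rise, the level step and the descents. All descents have the
  pattern weight of \<open>w\<close> and exponent zero in \<open>y\<close>; multiplying a monomial by its exponent \<open>k\<close> and
  dropping the power of \<open>y\<close> is the same as differentiating and setting \<open>y = 1\<close>.\<close>

lemma sum_weight_children:
  assumes "catalan_word w"
  shows "(\<Sum>c = run_start w..Suc (last w). weight (w @ [c])) =
    var_y * rise_weight w + weight w + [: poly (pderiv (weight w)) 1 :]"
proof -
  have w: "w \<noteq> []" "run_start w \<le> last w" "1 \<le> run_start w"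
    using assms run_start_le_last run_start_pos by (auto simp: catalan_word_def)
  have *: "weight (w @ [c]) = monom (mark (w @ [c])) (spread (w @ [c]))"
    if "c \<in> {run_start w..Suc (last w)}" for c
    using that w assms by (intro weight_eq) (auto simp: catalan_word_snoc)
  have "(\<Sum>c \<in> {run_start w..<last w}. weight (w @ [c])) =
      (\<Sum>c \<in> {run_start w..<last w}. [:mark w:])"
    using w by (intro sum.cong) (auto simp: * mark_snoc run_start_snoc monom_0)
  also have "\<dots> = [: poly (pderiv (weight w)) 1 :]"
    using assms by (simp add: weight_eq pderiv_monom poly_monom of_nat_poly)
  finally show ?thesis
    using w assms
    by (simp add: sum_children * mark_snoc run_start_snoc rise_weight_def weight_eq
        var_y_def Suc_diff_le monom_Suc del: sum.cl_ivl_Suc)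
qed

text \<open>Here the descents are told apart. With \<open>weight w = m y\<^sup>k\<close>, the value at 1 minus the
  constant coefficient is \<open>m\<close> for \<open>k > 0\<close> and 0 for \<open>k = 0\<close>: it counts the descent by one. What
  remains of the \<open>k\<close> descents are the \<open>k - 1\<close> deeper ones.\<close>

lemma sum_rise_weight_children:
  assumes "catalan_word w"
  shows "(\<Sum>c = run_start w..Suc (last w). rise_weight (w @ [c])) =
    var_y * rise_weight w + var_p * weight w +
    var_q * [: poly (weight w) 1 - coeff (weight w) 0 :] +
    var_r * [: poly (pderiv (weight w)) 1 - poly (weight w) 1 + coeff (weight w) 0 :]"
proof -
  have w: "w \<noteq> []" "run_start w \<le> last w"
    using assms run_start_le_last by (auto simp: catalan_word_def)
  have p: "var_p = [:mark_p:]" "var_q = [:mark_q:]" "var_r = [:mark_r:]"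
    by (simp_all add: var_p_def var_q_def var_r_def mark_p_def mark_q_def mark_r_def)
  have "(\<Sum>c \<in> {run_start w..<last w}. rise_weight (w @ [c])) =
      (\<Sum>c \<in> {run_start w..<last w}. [:(if last w = Suc c then mark_q else mark_r) * mark w:])"
    using w
    by (intro sum.cong) (auto simp: rise_weight_def mark_snoc rise_snoc run_start_snoc monom_0)
  also have "\<dots> = var_q * [: poly (weight w) 1 - coeff (weight w) 0 :] +
      var_r * [: poly (pderiv (weight w)) 1 - poly (weight w) 1 + coeff (weight w) 0 :]"
  proof (cases "run_start w = last w")
    case True
    then show ?thesis using assms by (simp add: weight_eq pderiv_monom poly_monom)
  next
    case False
    then obtain d where d: "last w = Suc d" "run_start w \<le> d"
      using w by (cases "last w") auto
    then have "{run_start w..<last w} = insert d {run_start w..<d}" by auto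
    moreover have "of_nat k * [:a:] = [:of_nat k * a:]" for k and a :: "int poly poly poly"
      by (simp add: of_nat_poly)
    ultimately show ?thesis using d assms
      by (simp add: weight_eq pderiv_monom poly_monom p Suc_diff_le algebra_simps
          del: of_nat_diff)
  qed
  finally show ?thesis
    using w assms
    by (simp add: sum_children mark_snoc rise_snoc run_start_snoc rise_weight_def weight_eq
        var_y_def Suc_diff_le monom_Suc p smult_monom del: sum.cl_ivl_Suc)
qed

section \<open>Solving the linear system\<close>

text \<open>\<open>G\<close> and \<open>H\<close> stand for the value of \<open>U\<close> at \<open>y = 1\<close> and for its derivative there. The
  equations for \<open>E\<close>, \<open>V\<close>, \<open>D\<close> express \<open>x y U\<close>, \<open>x G\<close>, \<open>x H\<close> by the other series, so \<open>U\<close>, \<open>G\<close>, \<open>H\<close>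
  drop out of their own equations once these are multiplied by \<open>x\<close>. The equation for \<open>H\<close> then relates \<open>D\<close> to \<open>V\<close>
  alone (step \<open>W\<close>), the one for \<open>Z\<close> relates \<open>Z\<close> to \<open>D\<close>, and what is left are one equation for \<open>V\<close>
  and one for \<open>E\<close>. No division takes place, so any commutative ring will do.\<close>

lemma linear_system_solution:
  fixes x y p q r E U V Z D G H :: "'a::comm_ring_1"
  assumes E: "E = x + x * (y * U + E + D)"
    and U: "U = x + x * (y * U + p * E + q * (V - Z) + r * (D - V + Z))"
    and V: "V = x + x * (G + V + D)"
    and Z: "Z = x + x * (Z + D)"
    and D: "D = x * (G + H + D)"
    and G: "G = x + x * (G + p * V + q * (V - Z) + r * (D - V + Z))"
    and H: "H = x * (G + H + p * D)"
  shows "V * ((1 - x) * (1 - 4 * x - (2 * p + q - 6) * x^2 + (3 * p + 2 * q - r - 4) * x^3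
              + (p - 1) * (p + q - r - 1) * x^4)) =
         x * (1 - 3 * x - (p + q - 4) * x^2 + (p + 2 * q - r - 2) * x^3
              + (p - 1) * (q - r) * x^4)"
    and "E * ((1 - x) * (1 - x - (p - 1) * x^2) * (1 - x - x * y - (p - 1) * x^2 * y)) =
         (x - 3 * x^2 - (p - 3) * x^3 + (p - 1) * x^4
                - x^3 * y * (q - 1 + (r - 2 * q + 1) * x + (p - 1) * (r - q) * x^2)) +
         (1 - x) * (x - x^2 + x^2 * y * (q - 1 + (r - 2 * q + 1) * x + (p - 1) * (r - q) * x^2)) * V"
proof -
  have xG: "x * G = V - x - x * V - x * D"
    using V by (simp add: algebra_simps)
  have xH: "x * H = D - V + x + x * V"
  proof -
    have "x * H = D - x * G - x * D" using D by (simp only: distrib_left eq_diff_eq ac_simps)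
    then show ?thesis unfolding xG by (simp add: algebra_simps)
  qed
  have "x * H = x * (x * G) + x * (x * H) + p * x^2 * D"
    by (subst H) (simp add: algebra_simps power2_eq_square)
  then have W: "D * (1 - x - (p - 1) * x^2) = V * (1 - x) - x"
    unfolding xH xG by (simp add: algebra_simps power2_eq_square)
  have Z': "(1 - x) * Z = x + x * D"
    using Z by (simp add: algebra_simps)
  have G': "x * G = x^2 + x * (x * G) + x^2 * (p * V + q * (V - Z) + r * (D - V + Z))"
    by (subst G) (simp add: algebra_simps power2_eq_square)
  define A where "A = 1 - x - (p - 1) * x^2"
  \<comment> \<open>\<open>g\<close> vanishes by the equation for \<open>G\<close>. Multiplied by \<open>(1 - x) A\<close> it contains \<open>Z\<close> and \<open>D\<close>
    only through \<open>(1 - x) Z\<close> and \<open>A D\<close>; the cofactors below are the coefficients with which these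
    two products have to be exchanged for \<open>x + x D\<close> and \<open>(1 - x) V - x\<close>.\<close>
  define g where "g = x^2 + x * (V - x - x * V - x * D) +
      x^2 * (p * V + q * (V - Z) + r * (D - V + Z)) - (V - x - x * V - x * D)"
  have "V * ((1 - x) * (1 - 4 * x - (2 * p + q - 6) * x^2 + (3 * p + 2 * q - r - 4) * x^3
              + (p - 1) * (p + q - r - 1) * x^4)) -
         x * (1 - 3 * x - (p + q - 4) * x^2 + (p + 2 * q - r - 2) * x^3
              + (p - 1) * (q - r) * x^4) =
    - (1 - x) * A * g + A * x^2 * (r - q) * ((1 - x) * Z - (x + x * D))
    + (x * (1 - x)^2 + x^2 * r * (1 - x) + x^3 * (r - q)) * (D * A - (V * (1 - x) - x))"
    unfolding A_def g_def
    by (simp add: algebra_simps power2_eq_square power3_eq_cube power4_eq_xxxx)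
  moreover have "g = 0" using G' unfolding g_def xG by simp
  ultimately show "V * ((1 - x) * (1 - 4 * x - (2 * p + q - 6) * x^2 + (3 * p + 2 * q - r - 4) * x^3
              + (p - 1) * (p + q - r - 1) * x^4)) =
         x * (1 - 3 * x - (p + q - 4) * x^2 + (p + 2 * q - r - 2) * x^3
              + (p - 1) * (q - r) * x^4)"
    unfolding Z' W[folded A_def] by simp
  have xyU: "x * (y * U) = E - x - x * E - x * D"
    using E by (simp add: algebra_simps)
  have U': "x * (y * U) = x^2 * y + x * y * (x * (y * U))
      + x^2 * y * (p * E + q * (V - Z) + r * (D - V + Z))"
    by (subst U) (simp add: algebra_simps power2_eq_square)
  \<comment> \<open>The same elimination, now with the equation for \<open>U\<close> in place of that for \<open>G\<close>.\<close>
  define u where "u = x^2 * y + x * y * (E - x - x * E - x * D) +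
      x^2 * y * (p * E + q * (V - Z) + r * (D - V + Z)) - (E - x - x * E - x * D)"
  have "E * ((1 - x) * (1 - x - (p - 1) * x^2) * (1 - x - x * y - (p - 1) * x^2 * y)) -
         ((x - 3 * x^2 - (p - 3) * x^3 + (p - 1) * x^4
                - x^3 * y * (q - 1 + (r - 2 * q + 1) * x + (p - 1) * (r - q) * x^2)) +
         (1 - x) * (x - x^2 + x^2 * y * (q - 1 + (r - 2 * q + 1) * x + (p - 1) * (r - q) * x^2)) * V) =
    - (1 - x) * A * u + A * x^2 * y * (r - q) * ((1 - x) * Z - (x + x * D))
    + ((1 - x) * (x * (1 - x * y) + x^2 * y * r) + x^3 * y * (r - q)) *
      (D * A - (V * (1 - x) - x))"
    unfolding A_def u_def
    by (simp add: algebra_simps power2_eq_square power3_eq_cube power4_eq_xxxx)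
  moreover have "u = 0" using U' unfolding u_def xyU by simp
  ultimately show "E * ((1 - x) * (1 - x - (p - 1) * x^2) * (1 - x - x * y - (p - 1) * x^2 * y)) =
         (x - 3 * x^2 - (p - 3) * x^3 + (p - 1) * x^4
                - x^3 * y * (q - 1 + (r - 2 * q + 1) * x + (p - 1) * (r - q) * x^2)) +
         (1 - x) * (x - x^2 + x^2 * y * (q - 1 + (r - 2 * q + 1) * x + (p - 1) * (r - q) * x^2)) * V"
    unfolding Z' W[folded A_def] by simp
qed

section \<open>Recurrences for the coefficients\<close>

definition rise_sum :: "nat \<Rightarrow> coeffs" where
  "rise_sum n = (\<Sum>w \<in> flat_catalan n. rise_weight w)"

lemma pderiv_sum: "pderiv (\<Sum>i \<in> A. f i) = (\<Sum>i \<in> A. pderiv (f i))"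
  by (induction A rule: infinite_finite_induct) (simp_all add: pderiv_add)

lemma sum_const_poly: "(\<Sum>i \<in> A. [:f i:]) = [:\<Sum>i \<in> A. f i:]"
  by (induction A rule: infinite_finite_induct) simp_all

lemma E_gf_nth_0: "fps_nth E_gf 0 = 0"
  by (simp add: E_gf_def flat_catalan_0)

lemma rise_sum_0: "rise_sum 0 = 0"
  by (simp add: rise_sum_def flat_catalan_0)

lemma one_letter_weights: "weight [Suc 0] = 1" "rise_weight [Suc 0] = 1"
  by (simp_all add: weight_def trun_def occurrences_eq_0 rise_weight_def rise_def mark_def
      monom_altdef)

text \<open>There are no words of length 0, so at \<open>n = 0\<close> the right-hand side vanishes apart from the
  correction 1, which stands for the one-letter word.\<close>

lemma E_gf_nth_Suc:
  "fps_nth E_gf (Suc n) = (if n = 0 then 1 else 0) +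
     (var_y * rise_sum n + fps_nth E_gf n + [: poly (pderiv (fps_nth E_gf n)) 1 :])"
proof (cases "n = 0")
  case True
  then show ?thesis
    by (simp add: E_gf_def rise_sum_def flat_catalan_0 flat_catalan_1 one_letter_weights)
next
  case False
  have "fps_nth E_gf (Suc n) = (\<Sum>w \<in> flat_catalan n.
      var_y * rise_weight w + weight w + [: poly (pderiv (weight w)) 1 :])"
    using False unfolding E_gf_def fps_nth_Abs_fps
    by (subst sum_flat_catalan_Suc)
      (auto simp: flat_catalan_def sum_weight_children simp del: sum.cl_ivl_Suc intro!: sum.cong)
  then show ?thesis using False
    by (simp add: E_gf_def rise_sum_def sum.distrib sum_distrib_left pderiv_sum poly_sum
        sum_const_poly)
qed

lemma rise_sum_Suc:
  "rise_sum (Suc n) = (if n = 0 then 1 else 0) +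
     (var_y * rise_sum n + var_p * fps_nth E_gf n +
      var_q * ([: poly (fps_nth E_gf n) 1 :] - [: coeff (fps_nth E_gf n) 0 :]) +
      var_r * ([: poly (pderiv (fps_nth E_gf n)) 1 :] - [: poly (fps_nth E_gf n) 1 :] +
        [: coeff (fps_nth E_gf n) 0 :]))"
proof (cases "n = 0")
  case True
  then show ?thesis
    by (simp add: E_gf_def rise_sum_def flat_catalan_0 flat_catalan_1 one_letter_weights)
next
  case False
  have "rise_sum (Suc n) = (\<Sum>w \<in> flat_catalan n.
      var_y * rise_weight w + var_p * weight w +
      var_q * [: poly (weight w) 1 - coeff (weight w) 0 :] +
      var_r * [: poly (pderiv (weight w)) 1 - poly (weight w) 1 + coeff (weight w) 0 :])"
    using False unfolding rise_sum_def
    by (subst sum_flat_catalan_Suc)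
      (auto simp: flat_catalan_def sum_rise_weight_children simp del: sum.cl_ivl_Suc
        intro!: sum.cong)
  then show ?thesis using False
    by (simp only: E_gf_def fps_nth_Abs_fps rise_sum_def sum.distrib sum_subtractf
        flip: sum_distrib_left)
      (simp add: pderiv_sum poly_sum coeff_sum sum.distrib sum_subtractf sum_const_poly)
qed

section \<open>Generating functions over the field of fractions\<close>

definition fract_gf :: "(nat \<Rightarrow> 'a::idom) \<Rightarrow> 'a fract fps" where
  "fract_gf f = to_fract_fps (Abs_fps f)"

lemma fract_gf_add: "fract_gf (\<lambda>n. f n + g n) = fract_gf f + fract_gf g"
  and fract_gf_diff: "fract_gf (\<lambda>n. f n - g n) = fract_gf f - fract_gf g"
  and fract_gf_cmult: "fract_gf (\<lambda>n. c * f n) = fps_const (to_fract c) * fract_gf f"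
  by (simp_all add: fract_gf_def to_fract_fps_def fps_eq_iff)

lemmas fract_gf_linear = fract_gf_add fract_gf_diff fract_gf_cmult

text \<open>The next two lemmas turn a recurrence for coefficients into an equation between series; the
  second one allows for an extra initial term at \<open>n = 1\<close>.\<close>

lemma fract_gf_step:
  assumes "f 0 = 0" "\<And>n. f (Suc n) = g n"
  shows "fract_gf f = fps_X * fract_gf g"
proof (rule fps_ext)
  fix n show "fps_nth (fract_gf f) n = fps_nth (fps_X * fract_gf g) n"
    by (cases n) (simp_all add: assms fract_gf_def to_fract_fps_def)
qed

lemma fract_gf_step_from_1:
  assumes "f 0 = 0" "\<And>n. f (Suc n) = (if n = 0 then 1 else 0) + g n"
  shows "fract_gf f = fps_X + fps_X * fract_gf g"
proof (rule fps_ext)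
  fix n show "fps_nth (fract_gf f) n = fps_nth (fps_X + fps_X * fract_gf g) n"
    by (cases n) (simp_all add: assms fract_gf_def to_fract_fps_def)
qed

theorem theorem3p3:
  fixes x y p q r E V \<alpha> \<beta> :: "coeffs fract fps"
  defines "x \<equiv> fps_X"
    and "y \<equiv> fps_const (to_fract var_y)"
    and "p \<equiv> fps_const (to_fract var_p)"
    and "q \<equiv> fps_const (to_fract var_q)"
    and "r \<equiv> fps_const (to_fract var_r)"
    and "E \<equiv> to_fract_fps E_gf"
    and "V \<equiv> to_fract_fps (set_y_1 E_gf)"
    and "\<alpha> \<equiv> 1 - 3 * x - (p + q - 4) * x^2 + (p + 2 * q - r - 2) * x^3
              + (p - 1) * (q - r) * x^4"
    and "\<beta> \<equiv> 1 - 4 * x - (2 * p + q - 6) * x^2 + (3 * p + 2 * q - r - 4) * x^3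
              + (p - 1) * (p + q - r - 1) * x^4"
  shows "E = (x - 3 * x^2 - (p - 3) * x^3 + (p - 1) * x^4
                - x^3 * y * (q - 1 + (r - 2 * q + 1) * x + (p - 1) * (r - q) * x^2))
             / ((1 - x) * (1 - x - (p - 1) * x^2) * (1 - x - x * y - (p - 1) * x^2 * y))
           + (x - x^2 + x^2 * y * (q - 1 + (r - 2 * q + 1) * x + (p - 1) * (r - q) * x^2))
             / ((1 - x - (p - 1) * x^2) * (1 - x - x * y - (p - 1) * x^2 * y)) * V
         \<and> V = x * \<alpha> / ((1 - x) * \<beta>)"
proof -
  define e where "e = fps_nth E_gf"
  define U where "U = fract_gf rise_sum"
  define Z where "Z = fract_gf (\<lambda>n. [: coeff (e n) 0 :])"
  define D where "D = fract_gf (\<lambda>n. [: poly (pderiv (e n)) 1 :])"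
  define G where "G = fract_gf (\<lambda>n. [: poly (rise_sum n) 1 :])"
  define H where "H = fract_gf (\<lambda>n. [: poly (pderiv (rise_sum n)) 1 :])"
  have E_eq: "E = fract_gf e"
    by (simp add: E_def e_def fract_gf_def fps_nth_inverse)
  have V_eq: "V = fract_gf (\<lambda>n. [: poly (e n) 1 :])"
    by (simp add: V_def e_def fract_gf_def set_y_1_def)
  note series = E_eq V_eq U_def Z_def D_def G_def H_def x_def y_def p_def q_def r_def
  have e0: "e 0 = 0" and u0: "rise_sum 0 = 0"
    by (simp_all add: e_def E_gf_nth_0 rise_sum_0)
  note e_Suc = E_gf_nth_Suc[folded e_def] and u_Suc = rise_sum_Suc[folded e_def]
  have poly_simps: "poly var_y 1 = 1" "coeff var_y 0 = 0" "pderiv var_y = 1"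
      "coeff (var_y * f) 0 = 0" for f
    by (simp_all add: var_y_def pderiv_pCons)
  have const_simps: "poly var_p 1 = mark_p" "poly var_q 1 = mark_q" "poly var_r 1 = mark_r"
    "pderiv var_p = 0" "pderiv var_q = 0" "pderiv var_r = 0"
    "var_p = [:mark_p:]" "var_q = [:mark_q:]" "var_r = [:mark_r:]"
    by (simp_all add: var_p_def var_q_def var_r_def mark_p_def mark_q_def mark_r_def pderiv_pCons)
  have eqE: "E = x + x * (y * U + E + D)"
    unfolding series fract_gf_linear[symmetric]
    by (rule fract_gf_step_from_1[OF e0 e_Suc])
  have eqU: "U = x + x * (y * U + p * E + q * (V - Z) + r * (D - V + Z))"
    unfolding series fract_gf_linear[symmetric]
    by (rule fract_gf_step_from_1[OF u0 u_Suc])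
  \<comment> \<open>Apply evaluation at 1, the constant coefficient and the derivative at 1 to the recurrences;
    the product rule for \<open>y U\<close> produces the sum \<open>G + H\<close>.\<close>
  have eqV: "V = x + x * (G + V + D)"
    unfolding series fract_gf_linear[symmetric]
    by (rule fract_gf_step_from_1) (simp_all add: e0 e_Suc u0 poly_simps flip: one_pCons)
  have eqZ: "Z = x + x * (Z + D)"
    unfolding series fract_gf_linear[symmetric]
    by (rule fract_gf_step_from_1) (simp_all add: e0 e_Suc u0 poly_simps flip: one_pCons)
  have eqD: "D = x * (G + H + D)"
    unfolding series fract_gf_linear[symmetric]
    by (rule fract_gf_step)
      (simp_all add: e0 e_Suc pderiv_add pderiv_mult pderiv_pCons poly_simps)
  have eqG: "G = x + x * (G + p * V + q * (V - Z) + r * (D - V + Z))"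
    unfolding series fract_gf_linear[symmetric]
    by (rule fract_gf_step_from_1)
      (simp_all add: u0 u_Suc e0 poly_simps const_simps flip: one_pCons)
  have eqH: "H = x * (G + H + p * D)"
    unfolding series fract_gf_linear[symmetric]
    by (rule fract_gf_step)
      (simp_all add: u0 u_Suc pderiv_add pderiv_mult pderiv_diff pderiv_pCons
        pderiv_smult poly_simps const_simps mult.commute)
  note sol = linear_system_solution[OF eqE eqU eqV eqZ eqD eqG eqH]
  \<comment> \<open>All denominators have constant coefficient 1, so they are units and the quotients are exact.\<close>
  have divI: "f = g / h" if "f * h = g" "fps_nth h 0 \<noteq> 0" for f g h :: "coeffs fract fps"
    using that by (metis fps_nonzeroI nonzero_mult_div_cancel_right)
  define A where "A = 1 - x - (p - 1) * x^2"
  define B where "B = 1 - x - x * y - (p - 1) * x^2 * y"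
  define N where "N = x - 3 * x^2 - (p - 3) * x^3 + (p - 1) * x^4
                - x^3 * y * (q - 1 + (r - 2 * q + 1) * x + (p - 1) * (r - q) * x^2)"
  define M where "M = x - x^2 + x^2 * y * (q - 1 + (r - 2 * q + 1) * x + (p - 1) * (r - q) * x^2)"
  have unit: "fps_nth (1 - x) 0 = 1" "fps_nth A 0 = 1" "fps_nth B 0 = 1" "fps_nth \<beta> 0 = 1"
    by (simp_all add: A_def B_def \<beta>_def x_def power2_eq_square power3_eq_cube power4_eq_xxxx)
  have "V = x * \<alpha> / ((1 - x) * \<beta>)"
    by (rule divI) (use sol(1) unit in \<open>simp_all add: \<alpha>_def \<beta>_def\<close>)
  moreover have "E = N / ((1 - x) * A * B) + M / (A * B) * V"
  proof -
    have "fps_nth (A * B) 0 = 1" "fps_nth ((1 - x) * A * B) 0 = 1"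
      using unit by simp_all
    then have div: "f / (A * B) * (A * B) = f"
      "f / ((1 - x) * A * B) * ((1 - x) * A * B) = f" for f
      by (simp_all add: fps_divide_unit mult.assoc inverse_mult_eq_1)
    have nz: "(1 - x) * A * B \<noteq> 0"
      using \<open>fps_nth ((1 - x) * A * B) 0 = 1\<close> by auto
    have "(N / ((1 - x) * A * B) + M / (A * B) * V) * ((1 - x) * A * B) =
        N / ((1 - x) * A * B) * ((1 - x) * A * B) + (1 - x) * (M / (A * B) * (A * B)) * V"
      by (simp add: algebra_simps)
    also have "\<dots> = E * ((1 - x) * A * B)"
      unfolding div using sol(2) by (simp add: A_def B_def N_def M_def)
    finally show ?thesis using nz by simp
  qed
  ultimately show ?thesis unfolding A_def B_def N_def M_def by blast
qed

end
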